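(* Let $p$ be a prime number, $\chi_1$ the principal Dirichlet character modulo $p$, $k$ a positive integer, and $z$ in the upper half-plane $\mathbb{H}=\{z\in\mathbb{C}:\operatorname{Im}z>0\}$. Then \begin{align*} (zp)^{2k}\mathfrak{F}_{2k+1,\chi_1}\!\left(-\frac{1}{p^2z}\right)-\mathfrak{F}_{2k+1,\chi_1}(z) &=\frac{p-1}{2}L(2k+1,\chi_1)\left\{(zp)^{2k}-1\right\}\\ &\quad+\frac{(2\pi i)^{2k+1}}{2z\,p^{2k+2}}\sum_{j=1}^{k}(p^{2j}-1)(p^{2k+2-2j}-1)\frac{B_{2j}}{(2j)!}\frac{B_{2k+2-2j}}{(2k+2-2j)!}(pz)^{2k+2-2j}. \end{align*}
   Context: Define $a_n=1$ if $\gcd(n,p)=1$ and $a_n=1-p$ if $p\mid n$; $\sigma_{-m,\chi_1}(n)=\sum_{d\mid n}\chi_1(d)d^{-m}$; and $\mathfrak{F}_{m,\chi_1}(z)=\sum_{n=1}^{\infty}a_n\,\sigma_{-m,\chi_1}(n)\exp(2\pi i n z)$ for $z\in\mathbb{H}$. $L(s,\chi)$ is the Dirichlet $L$-function and $B_m$ the $m$-th Bernoulli number. *)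

theory Defs
  imports
    "HOL-Analysis.Analysis"
    "HOL-Computational_Algebra.Computational_Algebra"
begin

text \<open>
  Dirichlet characters are represented as functions on the natural numbers, since they are only
  evaluated at positive integers below.
\<close>

definition principal_char :: "nat \<Rightarrow> nat \<Rightarrow> complex" where
  "principal_char q n = (if coprime n q then 1 else 0)"

text \<open>
  The Dirichlet series of \<open>\<psi>\<close>. It represents \<open>L(s, \<psi>)\<close> in the half-plane \<open>Re s > 1\<close> of absolute
  convergence, which is the only region where it is used; no analytic continuation is involved.
\<close>

definition dirichlet_L :: "complex \<Rightarrow> (nat \<Rightarrow> complex) \<Rightarrow> complex" where
  "dirichlet_L s \<psi> = (\<Sum>n. \<psi> (Suc n) / of_nat (Suc n) powr s)"

text \<open>
  Bernoulli numbers from \<open>t / (e\<^sup>t - 1) = (\<Sum>m. B\<^sub>m t\<^sup>m / m!)\<close>, so \<open>B\<^sub>1 = - 1 / 2\<close>.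
\<close>

definition bernoulli :: "nat \<Rightarrow> real" where
  "bernoulli m = fact m * fps_nth (fps_X / (fps_exp 1 - 1)) m"

definition divisor_sigma :: "int \<Rightarrow> (nat \<Rightarrow> complex) \<Rightarrow> nat \<Rightarrow> complex" where
  "divisor_sigma m \<psi> n = (\<Sum>d | d dvd n. \<psi> d * of_nat d powi m)"

text \<open>For prime \<open>p\<close>, the second case below is exactly \<open>p dvd n\<close>.\<close>

definition coeff_a :: "nat \<Rightarrow> nat \<Rightarrow> complex" where
  "coeff_a p n = (if gcd n p = 1 then 1 else 1 - of_nat p)"

definition frakF :: "nat \<Rightarrow> nat \<Rightarrow> (nat \<Rightarrow> complex) \<Rightarrow> complex \<Rightarrow> complex" where
  "frakF p m \<psi> z =
     (\<Sum>n. coeff_a p (Suc n) * divisor_sigma (- int m) \<psi> (Suc n)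
            * exp (2 * of_real pi * \<i> * of_nat (Suc n) * z))"

end

theory Submission
  imports Defs
begin

text \<open>
  Put \<open>\<tau> = p z\<close> and let \<open>D\<close> be the set of positive integers prime to \<open>p\<close>. Since \<open>a\<^sub>d\<^sub>m = a\<^sub>m\<close> for \<open>d \<in> D\<close>,
  \<open>\<FF>(z)\<close> is the sum over \<open>d \<in> D\<close> of \<open>d\<^sup>-\<^sup>2\<^sup>k\<^sup>-\<^sup>1 \<Sum>\<^sub>m a\<^sub>m exp (2 \<pi> i m d z)\<close>, and the inner series is
  \<open>(p - 1) / 2 + (i / 2) (cot (\<pi> d z) - p cot (\<pi> p d z))\<close>. In the partial fraction expansion of this
  difference of cotangents the terms divisible by \<open>p\<close> cancel, so that
  \<open>\<FF>(z) - (p - 1) / 2 L(2k+1)\<close> equals \<open>- i p \<tau> / \<pi>\<close> times the absolutely convergent sum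
  \<open>T(\<tau>) = \<Sum> 1 / (d\<^sup>2\<^sup>k (\<tau>\<^sup>2 d\<^sup>2 - n\<^sup>2))\<close> over \<open>D \<times> D\<close>. Replacing \<open>z\<close> by \<open>- 1 / (p\<^sup>2 z)\<close> replaces \<open>\<tau>\<close> by
  \<open>- 1 / \<tau>\<close>, which exchanges the roles of \<open>d\<close> and \<open>n\<close>; in the difference the quadratic denominators
  are cancelled by a finite geometric sum, leaving products of values of the zeta function at even
  integers, with the Euler factor at \<open>p\<close> removed.
\<close>

subsection \<open>Partial fractions of the cotangent\<close>

lemma sin_pi_eq_0_iff:
  fixes w :: complex
  shows "sin (of_real pi * w) = 0 \<longleftrightarrow> w \<in> \<int>"
proof -
  have "sin (of_real pi * w) = 0 \<longleftrightarrow> (\<exists>n::int. of_real pi * w = of_real (of_int n * pi))"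
    by (rule sin_eq_0)
  also have "\<dots> \<longleftrightarrow> w \<in> \<int>"
    by (auto simp: Ints_def field_simps)
  finally show ?thesis .
qed

text \<open>Logarithmic derivative of the reflection formula: both sides of
  \<open>Gamma z * Gamma (1 - z) = pi / sin (pi z)\<close> are differentiated and the common nonzero
  factor is cancelled. It lets the series defining \<open>Digamma\<close> produce the partial
  fractions of the cotangent.\<close>

lemma Digamma_reflection:
  fixes w :: complex
  assumes "w \<notin> \<int>"
  shows "Digamma (1 - w) - Digamma w = of_real pi * cot (of_real pi * w)"
proof -
  have sin: "sin (of_real pi * w) \<noteq> 0"
    using assms sin_pi_eq_0_iff by blast
  have w: "w \<notin> \<int>\<^sub>\<le>\<^sub>0"
    using assms nonpos_Ints_Int by blast
  have w': "1 - w \<notin> \<int>\<^sub>\<le>\<^sub>0"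
  proof
    assume "1 - w \<in> \<int>\<^sub>\<le>\<^sub>0"
    hence "1 - (1 - w) \<in> \<int>"
      using Ints_diff[OF Ints_1 nonpos_Ints_Int] by blast
    with assms show False by simp
  qed
  have "((\<lambda>z. Gamma z * Gamma (1 - z)) has_field_derivative
          Gamma w * Gamma (1 - w) * (Digamma w - Digamma (1 - w))) (at w)"
    using w w' by (auto intro!: derivative_eq_intros simp: algebra_simps)
  moreover have "((\<lambda>z. of_real pi / sin (of_real pi * z)) has_field_derivative
          - of_real pi * (cos (of_real pi * w) * of_real pi) / (sin (of_real pi * w))\<^sup>2) (at w)"
    using sin by (auto intro!: derivative_eq_intros simp: power2_eq_square)
  ultimately have "of_real pi / sin (of_real pi * w) * (Digamma w - Digamma (1 - w)) =
          - of_real pi * (cos (of_real pi * w) * of_real pi) / (sin (of_real pi * w))\<^sup>2"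
    unfolding Gamma_reflection_complex by (rule DERIV_unique)
  hence "of_real pi / sin (of_real pi * w) * (Digamma w - Digamma (1 - w)) =
         of_real pi / sin (of_real pi * w) * (- (of_real pi * cot (of_real pi * w)))"
    by (simp add: cot_def power2_eq_square)
  hence "Digamma w - Digamma (1 - w) = - (of_real pi * cot (of_real pi * w))"
    using sin by (subst (asm) mult_left_cancel) auto
  thus ?thesis by (simp add: algebra_simps)
qed

text \<open>The set \<open>A\<close> may contain 0, where the summand is 0 because division by zero
  yields 0.\<close>

lemma summable_on_inverse_power:
  assumes "m \<ge> 2"
  shows "(\<lambda>n::nat. 1 / real n ^ m) summable_on A"
proof -
  have "summable (\<lambda>n. inverse (real n ^ m))"
    using inverse_power_summable[OF assms, where 'a = real] by simp
  hence "(\<lambda>n::nat. 1 / real n ^ m) summable_on UNIV"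
    by (subst summable_on_UNIV_nonneg_real_iff) (auto simp: field_simps)
  thus ?thesis by (rule summable_on_subset_banach) auto
qed

text \<open>Every double series below is dominated by such a product, which is what licenses each
  exchange of summation order.\<close>

lemma summable_on_times_product:
  fixes f :: "'a \<Rightarrow> real" and g :: "'b \<Rightarrow> real"
  assumes "f summable_on A" "g summable_on B"
  assumes "\<And>x. x \<in> A \<Longrightarrow> f x \<ge> 0" "\<And>y. y \<in> B \<Longrightarrow> g y \<ge> 0"
  shows "(\<lambda>(x, y). f x * g y) summable_on A \<times> B"
proof (rule summable_on_SigmaI)
  show "((\<lambda>y. case (x, y) of (x, y) \<Rightarrow> f x * g y) has_sum (f x * infsum g B)) B" for x
    using has_sum_cmult_right[OF has_sum_infsum[OF assms(2)]] by simp
  show "(\<lambda>x. f x * infsum g B) summable_on A"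
    by (rule summable_on_cmult_left[OF assms(1)])
qed (use assms in auto)

text \<open>Reflection together with the shift \<open>Digamma (1 + w) = Digamma w + 1 / w\<close>
  turns the right-hand side into \<open>Digamma (1 - w) - Digamma (1 + w)\<close>. Subtracting the
  two series for \<open>Digamma\<close> termwise cancels the parts that do not depend on
  \<open>w\<close>.\<close>

lemma cot_partial_fractions:
  fixes w :: complex
  assumes "w \<notin> \<int>"
  shows "((\<lambda>n. 2 * w / (w\<^sup>2 - of_nat n ^ 2)) has_sum
           (of_real pi * cot (of_real pi * w) - 1 / w)) {1..}"
proof -
  have w0: "w \<noteq> 0" using assms by auto
  have nz: "w - of_nat n \<noteq> 0" "w + of_nat n \<noteq> 0" for n
    using assms by (metis Ints_of_nat eq_iff_diff_eq_0)
      (metis Ints_of_nat Ints_minus add_eq_0_iff2 assms)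
  have nz1: "1 - w \<noteq> 0" "1 + w \<noteq> 0"
    using nz[of 1] by (auto simp: add_ac)
  have eq: "of_real pi * cot (of_real pi * w) - 1 / w = Digamma (1 - w) - Digamma (1 + w)"
    using Digamma_reflection[OF assms] Digamma_plus1[OF w0] by (simp add: add_ac)
  have dg: "(\<lambda>n. inverse (of_nat (Suc n)) - inverse (z + of_nat n)) sums
          (Digamma z + euler_mascheroni)" if "z \<noteq> 0" for z :: complex
    using summable_Digamma[OF that] by (simp add: Digamma_def summable_sums)
  have "(\<lambda>n. (inverse (of_nat (Suc n)) - inverse ((1 - w) + of_nat n)) -
             (inverse (of_nat (Suc n)) - inverse ((1 + w) + of_nat n))) sums
          ((Digamma (1 - w) + euler_mascheroni) - (Digamma (1 + w) + euler_mascheroni))"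
    by (intro sums_diff dg nz1)
  also have "(\<lambda>n. (inverse (of_nat (Suc n)) - inverse ((1 - w) + of_nat n)) -
             (inverse (of_nat (Suc n)) - inverse ((1 + w) + of_nat n))) =
        (\<lambda>n. 2 * w / (w\<^sup>2 - of_nat (Suc n) ^ 2))"
  proof
    fix n
    define x where "x = (of_nat (Suc n) :: complex)"
    have x: "x - w \<noteq> 0" "x + w \<noteq> 0"
      using nz[of "Suc n"] by (auto simp: x_def add_ac)
    have eq: "w\<^sup>2 - x\<^sup>2 = - ((x - w) * (x + w))"
      by (simp add: power2_eq_square algebra_simps)
    have "(inverse x - inverse (x - w)) - (inverse x - inverse (x + w)) = 2 * w / (w\<^sup>2 - x\<^sup>2)"
      unfolding eq divide_minus_right using x by (simp add: divide_simps) (simp add: algebra_simps)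
    moreover have "(1 - w) + of_nat n = x - w" "(1 + w) + of_nat n = x + w"
      by (simp_all add: x_def)
    ultimately show "(inverse (of_nat (Suc n)) - inverse ((1 - w) + of_nat n)) -
             (inverse (of_nat (Suc n)) - inverse ((1 + w) + of_nat n)) =
             2 * w / (w\<^sup>2 - of_nat (Suc n) ^ 2)"
      by (simp only: x_def)
  qed
  also have "(Digamma (1 - w) + euler_mascheroni) - (Digamma (1 + w) + euler_mascheroni) =
             of_real pi * cot (of_real pi * w) - 1 / w"
    using eq by simp
  finally have sums: "(\<lambda>n. 2 * w / (w\<^sup>2 - of_nat (Suc n) ^ 2)) sums
           (of_real pi * cot (of_real pi * w) - 1 / w)" .
  \<comment> \<open>So far the series converges only in its natural order; \<open>has_sum\<close>
    needs absolute convergence. Once N = \<open>Suc n\<close> satisfies N^2 >= 2 |w|^2, the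
    denominator has norm at least N^2 / 2, so the terms are at most 4 |w| / N^2.\<close>
  have "summable (\<lambda>n. norm (2 * w / (w\<^sup>2 - of_nat (Suc n) ^ 2)))"
  proof (rule summable_comparison_test_ev)
    have "eventually (\<lambda>n. real (Suc n) ^ 2 \<ge> 2 * norm w ^ 2) at_top"
      using eventually_ge_at_top[of "nat \<lceil>2 * norm w ^ 2\<rceil>"]
    proof eventually_elim
      case (elim n)
      have "2 * norm w ^ 2 \<le> real (Suc n) * 1" using elim unfolding nat_ceiling_le_eq by simp
      also have "\<dots> \<le> real (Suc n) * real (Suc n)"
        by (intro mult_left_mono) auto
      finally show ?case by (simp add: power2_eq_square)
    qed
    thus "eventually (\<lambda>n. norm (norm (2 * w / (w\<^sup>2 - of_nat (Suc n) ^ 2))) \<le>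
            4 * norm w * (1 / real (Suc n) ^ 2)) at_top"
    proof eventually_elim
      case (elim n)
      have "real (Suc n) ^ 2 / 2 \<le> real (Suc n) ^ 2 - norm w ^ 2"
        using elim by simp
      also have "\<dots> = norm (of_nat (Suc n) ^ 2 :: complex) - norm (w\<^sup>2)"
        by (simp add: norm_power del: of_nat_Suc)
      also have "\<dots> \<le> norm (w\<^sup>2 - of_nat (Suc n) ^ 2)"
        by (metis norm_minus_commute norm_triangle_ineq2)
      finally have "norm (2 * w) / norm (w\<^sup>2 - of_nat (Suc n) ^ 2) \<le> norm (2 * w) / (real (Suc n) ^ 2 / 2)"
        by (intro divide_left_mono mult_pos_pos) (auto simp del: of_nat_Suc intro: less_le_trans[rotated])
      thus ?case by (simp add: norm_divide norm_mult)
    qed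
    have "summable (\<lambda>n. 1 / real n ^ 2)"
      using inverse_power_summable[of 2, where 'a = real] by (simp add: field_simps)
    thus "summable (\<lambda>n. 4 * norm w * (1 / real (Suc n) ^ 2))"
      by (intro summable_mult) (subst summable_Suc_iff)
  qed
  hence "((\<lambda>n. 2 * w / (w\<^sup>2 - of_nat (Suc n) ^ 2)) has_sum
           (of_real pi * cot (of_real pi * w) - 1 / w)) UNIV"
    using sums by (rule norm_summable_imp_has_sum)
  also have "?this \<longleftrightarrow> ?thesis"
    by (intro has_sum_reindex_bij_witness[of _ "\<lambda>n. n - 1" Suc]) auto
  finally show ?thesis .
qed

text \<open>This form serves two purposes: in the upper half-plane it is the closed form of a
  geometric series, and near 0 it is the generating function of the Bernoulli numbers up to a linear
  term.\<close>

lemma cot_conv_exp: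
  fixes w :: complex
  assumes "w \<notin> \<int>"
  shows "exp (2 * of_real pi * \<i> * w) \<noteq> 1"
    and "cot (of_real pi * w) = \<i> * (1 + 2 / (exp (2 * of_real pi * \<i> * w) - 1))"
proof -
  define E where "E = exp (\<i> * (of_real pi * w))"
  have E0: "E \<noteq> 0" by (simp add: E_def)
  have Em: "exp (- (\<i> * (of_real pi * w))) = 1 / E"
    by (simp add: E_def exp_minus field_simps)
  have q: "exp (2 * of_real pi * \<i> * w) = E\<^sup>2"
    by (simp add: E_def exp_double [symmetric] mult_ac)
  have sin: "sin (of_real pi * w) = (E - 1 / E) / (2 * \<i>)"
    by (simp add: sin_exp_eq Em) (simp add: E_def)
  have cos: "cos (of_real pi * w) = (E + 1 / E) / 2"
    by (simp add: cos_exp_eq Em) (simp add: E_def)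
  have "sin (of_real pi * w) \<noteq> 0"
    using assms sin_pi_eq_0_iff by blast
  moreover have "E - 1 / E = (E * E - 1) / E" using E0 by (simp add: field_simps)
  ultimately have E1: "E * E \<noteq> 1" unfolding sin by auto
  thus "exp (2 * of_real pi * \<i> * w) \<noteq> 1"
    by (simp add: q power2_eq_square)
  have "E - 1 / E \<noteq> 0" "E * E - 1 \<noteq> 0" using E0 E1 by (auto simp: field_simps)
  thus "cot (of_real pi * w) = \<i> * (1 + 2 / (exp (2 * of_real pi * \<i> * w) - 1))"
    using E0 E1 by (simp add: q cot_def sin cos power2_eq_square) (simp add: field_simps)
qed

lemma coprime_prime_iff:
  fixes p :: nat
  assumes "prime p"
  shows "coprime n p \<longleftrightarrow> \<not> p dvd n"
  using assms by (metis coprime_commute prime_imp_coprime not_coprimeI dvd_refl not_prime_unit)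

subsection \<open>The Lambert series as a sum of cotangents\<close>

lemma not_Ints_of_Im_pos: "Im w > 0 \<Longrightarrow> w \<notin> \<int>"
  by (auto elim!: Ints_cases)

text \<open>The expansion at \<open>of_nat p * w\<close>, multiplied by \<open>p\<close>, runs over
  all n >= 1. The expansion at \<open>w\<close>, reindexed by n -> p n, is the same family
  restricted to the multiples of \<open>p\<close>. Their difference leaves the n prime to
  \<open>p\<close>, and the two terms 1 / w cancel.\<close>

lemma cot_diff_partial_fractions:
  fixes p :: nat and w :: complex
  assumes p: "prime p" and w: "Im w > 0"
  shows "((\<lambda>n. 2 * of_nat p ^ 2 * w / ((of_nat p * w)\<^sup>2 - of_nat n ^ 2)) has_sum
           (of_real pi * (of_nat p * cot (of_real pi * (of_nat p * w)) - cot (of_real pi * w))))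
           {n. coprime n p}"
proof -
  define f where "f = (\<lambda>n. 2 * of_nat p ^ 2 * w / ((of_nat p * w)\<^sup>2 - of_nat n ^ 2))"
  have p0: "p > 0" using p by (simp add: prime_gt_0_nat)
  have w0: "w \<noteq> 0" using w by auto
  have pw: "Im (of_nat p * w) > 0" using w p0 by simp
  have "((\<lambda>n. of_nat p * (2 * (of_nat p * w) / ((of_nat p * w)\<^sup>2 - of_nat n ^ 2))) has_sum
          (of_nat p * (of_real pi * cot (of_real pi * (of_nat p * w)) - 1 / (of_nat p * w)))) {1..}"
    by (intro has_sum_cmult_right cot_partial_fractions not_Ints_of_Im_pos pw)
  moreover have "of_nat p * (of_real pi * cot (of_real pi * (of_nat p * w)) - 1 / (of_nat p * w)) =
                  of_nat p * of_real pi * cot (of_real pi * (of_nat p * w)) - 1 / w"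
    using p0 w0 by (simp add: right_diff_distrib)
  moreover have "(\<lambda>n. of_nat p * (2 * (of_nat p * w) / ((of_nat p * w)\<^sup>2 - of_nat n ^ 2))) = f"
    by (simp add: f_def power2_eq_square mult_ac)
  ultimately have 1: "(f has_sum (of_nat p * of_real pi * cot (of_real pi * (of_nat p * w)) - 1 / w)) {1..}"
    by simp
  have "((\<lambda>n. 2 * w / (w\<^sup>2 - of_nat n ^ 2)) has_sum (of_real pi * cot (of_real pi * w) - 1 / w)) {1..}"
    by (intro cot_partial_fractions not_Ints_of_Im_pos w)
  also have "?this \<longleftrightarrow> (f has_sum (of_real pi * cot (of_real pi * w) - 1 / w)) {n \<in> {1..}. p dvd n}"
  proof (intro has_sum_reindex_bij_witness[of _ "\<lambda>n. n div p" "\<lambda>n. p * n"])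
    fix n :: nat assume "n \<in> {1..}"
    have "(of_nat p * w)\<^sup>2 - of_nat (p * n) ^ 2 = of_nat p ^ 2 * (w\<^sup>2 - of_nat n ^ 2)"
      by (simp add: algebra_simps power_mult_distrib)
    thus "f (p * n) = 2 * w / (w\<^sup>2 - of_nat n ^ 2)"
      using p0 by (simp add: f_def)
  qed (use p0 in \<open>auto elim!: dvdE\<close>)
  finally have 2: "(f has_sum (of_real pi * cot (of_real pi * w) - 1 / w)) {n \<in> {1..}. p dvd n}" .
  have "(f has_sum (of_nat p * of_real pi * cot (of_real pi * (of_nat p * w)) - 1 / w -
                    (of_real pi * cot (of_real pi * w) - 1 / w))) ({1..} - {n \<in> {1..}. p dvd n})"
    by (intro has_sum_Diff 1 2) auto
  also have "{1..} - {n \<in> {1..}. p dvd n} = {n. coprime n p}"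
    using p by (auto simp: coprime_prime_iff Suc_le_eq intro!: Nat.gr0I)
  finally show ?thesis by (simp add: f_def algebra_simps)
qed

lemma coeff_a_eq:
  assumes "prime p"
  shows "coeff_a p n = 1 - (if p dvd n then of_nat p else 0)"
  using coprime_prime_iff[OF assms, of n] by (auto simp: coeff_a_def coprime_iff_gcd_eq_1)

lemma norm_exp_lt_1:
  assumes "Im w > 0"
  shows "norm (exp (2 * of_real pi * \<i> * w)) < 1"
  using assms by simp

text \<open>By \<open>coeff_a_eq\<close> the series is the geometric series at \<open>w\<close>
  minus \<open>p\<close> times the one at \<open>of_nat p * w\<close>. The constant (p - 1) / 2
  collects the terms -1/2 of the two closed forms.\<close>

lemma has_sum_coeff_a:
  fixes p :: nat and w :: complex
  assumes p: "prime p" and w: "Im w > 0"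
  shows "((\<lambda>m. coeff_a p m * exp (2 * of_real pi * \<i> * of_nat m * w)) has_sum
           ((of_nat p - 1) / 2 + \<i> / 2 * (cot (of_real pi * w)
             - of_nat p * cot (of_real pi * (of_nat p * w))))) {1..}"
proof -
  have p0: "p > 0" using p by (simp add: prime_gt_0_nat)
  have pw: "Im (of_nat p * w) > 0" using w p0 by simp
  define e where "e = (\<lambda>w. exp (2 * of_real pi * \<i> * w))"
  \<comment> \<open>With q = \<open>e w\<close>, the geometric sum q / (1 - q) is rewritten through
    \<open>cot_conv_exp\<close>.\<close>
  have geom: "((\<lambda>m. e (of_nat m * w)) has_sum (-1 / 2 + \<i> / 2 * cot (of_real pi * w))) {1..}"
    if w: "Im w > 0" for w
  proof -
    have eq: "e (of_nat m * w) = e w ^ m" for m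
      unfolding e_def exp_of_nat_mult [symmetric] by (simp add: mult_ac)
    have "((\<lambda>m. e w ^ m) has_sum (e w / (1 - e w))) {1..}"
      unfolding e_def using norm_exp_lt_1[OF w] by (rule has_sum_geometric_from_1)
    moreover have "e w \<noteq> 1" "cot (of_real pi * w) = \<i> * (1 + 2 / (e w - 1))"
      using cot_conv_exp[OF not_Ints_of_Im_pos[OF w]] by (simp_all add: e_def)
    hence "-1 / 2 + \<i> / 2 * cot (of_real pi * w) = e w / (1 - e w)"
      by (simp add: divide_simps) (simp add: algebra_simps)
    ultimately show ?thesis by (simp add: eq)
  qed
  have "((\<lambda>m. of_nat p * e (of_nat m * (of_nat p * w))) has_sum
          (of_nat p * (-1 / 2 + \<i> / 2 * cot (of_real pi * (of_nat p * w))))) {1..}"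
    by (intro has_sum_cmult_right geom pw)
  also have "?this \<longleftrightarrow> ((\<lambda>m. of_nat p * e (of_nat m * w)) has_sum
      (of_nat p * (-1 / 2 + \<i> / 2 * cot (of_real pi * (of_nat p * w))))) {n \<in> {1..}. p dvd n}"
    by (intro has_sum_reindex_bij_witness[of _ "\<lambda>n. n div p" "\<lambda>n. p * n"])
       (use p0 in \<open>auto elim!: dvdE simp: mult_ac\<close>)
  also have "\<dots> \<longleftrightarrow> ((\<lambda>m. (if p dvd m then of_nat p else 0) * e (of_nat m * w)) has_sum
      (of_nat p * (-1 / 2 + \<i> / 2 * cot (of_real pi * (of_nat p * w))))) {1..}"
    by (intro has_sum_cong_neutral) auto
  finally have "((\<lambda>m. e (of_nat m * w) + - ((if p dvd m then of_nat p else 0) * e (of_nat m * w))) has_sum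
      (-1 / 2 + \<i> / 2 * cot (of_real pi * w) +
       - (of_nat p * (-1 / 2 + \<i> / 2 * cot (of_real pi * (of_nat p * w)))))) {1..}"
    by (intro has_sum_add geom w has_sum_uminusI)
  also have "(\<lambda>m. e (of_nat m * w) + - ((if p dvd m then of_nat p else 0) * e (of_nat m * w))) =
             (\<lambda>m. coeff_a p m * exp (2 * of_real pi * \<i> * of_nat m * w))"
    by (simp add: coeff_a_eq[OF p] e_def algebra_simps fun_eq_iff)
  finally show ?thesis by (simp add: algebra_simps diff_divide_distrib)
qed

lemma norm_coeff_a_le:
  assumes "prime p"
  shows "norm (coeff_a p n) \<le> real p"
proof -
  have p: "p \<ge> 1" using assms prime_ge_1_nat by blast
  hence "1 - of_nat p = - complex_of_real (real (p - 1))"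
    by (simp add: of_nat_diff)
  hence "norm (1 - of_nat p :: complex) = real (p - 1)"
    by (metis norm_minus_cancel norm_of_real abs_of_nat)
  thus ?thesis using p by (auto simp: coeff_a_def)
qed

text \<open>One absolutely convergent family over pairs (d, m) is summed in two ways: over m for
  fixed d, which gives cotangents by \<open>has_sum_coeff_a\<close>, and by the product n = d m,
  which gives the coefficients of the series defining \<open>frakF\<close>.\<close>

lemma frakF_has_sum:
  fixes p s :: nat and z :: complex
  assumes p: "prime p" and s: "s \<ge> 2" and z: "Im z > 0"
  shows "((\<lambda>d. ((of_nat p - 1) / 2 + \<i> / 2 * (cot (of_real pi * (of_nat d * z))
             - of_nat p * cot (of_real pi * (of_nat p * (of_nat d * z))))) / of_nat d ^ s)
           has_sum frakF p s (principal_char p) z) {d. coprime d p}"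
proof -
  define q where "q = norm (exp (2 * of_real pi * \<i> * z))"
  define D where "D = {d. coprime d p}"
  define f where "f = (\<lambda>(d, m). coeff_a p m * exp (2 * of_real pi * \<i> * of_nat m * (of_nat d * z)) / of_nat d ^ s)"
  define S where "S = infsum f (D \<times> {1..})"
  have D_pos: "d > 0" if "d \<in> D" for d
    using that p by (auto simp: D_def intro!: Nat.gr0I)
  have q: "0 \<le> q" "q < 1" using norm_exp_lt_1[OF z] by (auto simp: q_def)
  have norm_exp: "norm (exp (2 * of_real pi * \<i> * of_nat n * z)) = q ^ n" for n
  proof -
    have "exp (2 * of_real pi * \<i> * of_nat n * z) = exp (2 * of_real pi * \<i> * z) ^ n"
      by (simp add: exp_of_nat_mult [symmetric] mult_ac)
    thus ?thesis by (simp add: q_def norm_power)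
  qed
  \<comment> \<open>Since d >= 1 and q < 1, q^(m d) <= q^m, so the bound p q^m / d^s separates the
    variables.\<close>
  have "(\<lambda>x. norm (f x)) summable_on D \<times> {1..}"
  proof (rule Infinite_Sum.abs_summable_on_comparison_test')
    have "(\<lambda>m. q ^ m) summable_on {1..}"
      using has_sum_geometric_from_1[of q] q by (auto simp: summable_on_def)
    hence "(\<lambda>(d, m). (1 / real d ^ s) * (real p * q ^ m)) summable_on D \<times> {1..}"
      using q by (intro summable_on_times_product summable_on_inverse_power s summable_on_cmult_right) auto
    thus "(\<lambda>x. (1 / real (fst x) ^ s) * (real p * q ^ snd x)) summable_on D \<times> {1..}"
      by (simp add: case_prod_unfold)
  next
    fix x :: "nat \<times> nat"
    assume x: "x \<in> D \<times> {1..}"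
    obtain d m where [simp]: "x = (d, m)" by (cases x)
    have d: "d > 0" using x D_pos by auto
    have "exp (2 * of_real pi * \<i> * of_nat m * (of_nat d * z)) = exp (2 * of_real pi * \<i> * of_nat (m * d) * z)"
      by (simp add: mult_ac)
    hence "norm (f x) = norm (coeff_a p m) * q ^ (m * d) / real d ^ s"
      by (simp only: f_def norm_mult norm_divide norm_power norm_exp norm_of_nat split \<open>x = (d, m)\<close>)
    also have "\<dots> \<le> real p * q ^ m / real d ^ s"
      using q d by (intro divide_right_mono mult_mono norm_coeff_a_le p power_decreasing) auto
    finally show "norm (f x) \<le> (1 / real (fst x) ^ s) * (real p * q ^ snd x)" by simp
  qed
  from abs_summable_summable[OF this] have S: "(f has_sum S) (D \<times> {1..})"
    unfolding S_def by (rule has_sum_infsum)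
  have inner: "((\<lambda>m. f (d, m)) has_sum (((of_nat p - 1) / 2 + \<i> / 2 * (cot (of_real pi * (of_nat d * z))
             - of_nat p * cot (of_real pi * (of_nat p * (of_nat d * z))))) / of_nat d ^ s)) {1..}"
    if "d \<in> D" for d
    unfolding f_def split using D_pos[OF that] z
    by (intro has_sum_divide_const has_sum_coeff_a p) auto
  have 1: "((\<lambda>d. ((of_nat p - 1) / 2 + \<i> / 2 * (cot (of_real pi * (of_nat d * z))
             - of_nat p * cot (of_real pi * (of_nat p * (of_nat d * z))))) / of_nat d ^ s)
           has_sum S) D"
    by (rule has_sum_SigmaD[OF S inner])
  define a where "a = (\<lambda>n. coeff_a p n * divisor_sigma (- int s) (principal_char p) n
            * exp (2 * of_real pi * \<i> * of_nat n * z))"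
  define g where "g = (\<lambda>(n, d). coeff_a p n * exp (2 * of_real pi * \<i> * of_nat n * z) / of_nat d ^ s)"
  define B where "B = (\<lambda>n. {d. d dvd n \<and> coprime d p})"
  \<comment> \<open>A factor prime to \<open>p\<close> does not affect divisibility by
    \<open>p\<close>; hence the coefficient may be read off at n = d m.\<close>
  have coeff_a_mult: "coeff_a p (d * m) = coeff_a p m" if "d \<in> D" for d m
    using that p by (simp add: coeff_a_eq prime_dvd_mult_iff D_def coprime_prime_iff)
  \<comment> \<open>Pairs (d, m) correspond to pairs of some n >= 1 and a divisor d of n prime to
    \<open>p\<close>.\<close>
  have "(f has_sum S) (D \<times> {1..}) \<longleftrightarrow> (g has_sum S) (Sigma {1..} B)"
  proof (rule has_sum_reindex_bij_witness[of _ "\<lambda>(n, d). (d, n div d)" "\<lambda>(d, m). (d * m, d)"], goal_cases)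
    case (5 x)
    thus ?case using coeff_a_mult by (auto simp: f_def g_def mult_ac)
  next
    case (2 x)
    thus ?case using D_pos by (fastforce simp: B_def D_def Suc_le_eq)
  qed (use D_pos in \<open>auto simp: B_def D_def Suc_le_eq dvd_imp_le div_greater_zero_iff\<close>)
  with S have S': "(g has_sum S) (Sigma {1..} B)" by blast
  have "(a has_sum S) {1..}"
  proof (rule has_sum_SigmaD[OF S'])
    fix n :: nat assume n: "n \<in> {1..}"
    have [simp]: "finite {d. d dvd n}" using n by simp
    have fin: "finite (B n)" unfolding B_def by (rule finite_subset[of _ "{d. d dvd n}"]) auto
    \<comment> \<open>The principal character vanishes at the divisors outside
      \<open>B n\<close>.\<close>
    have "divisor_sigma (- int s) (principal_char p) n = (\<Sum>d\<in>B n. principal_char p d * of_nat d powi - int s)"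
      unfolding divisor_sigma_def by (rule sum.mono_neutral_right) (auto simp: B_def principal_char_def)
    also have "\<dots> = (\<Sum>d\<in>B n. 1 / of_nat d ^ s)"
      by (rule sum.cong) (auto simp: B_def principal_char_def power_int_minus field_simps)
    finally have "a n = (\<Sum>d\<in>B n. g (n, d))"
      by (simp add: a_def g_def sum_distrib_left sum_distrib_right mult_ac)
    thus "((\<lambda>d. g (n, d)) has_sum a n) (B n)"
      using has_sum_finite[OF fin] by simp
  qed
  also have "?this \<longleftrightarrow> ((\<lambda>n. a (Suc n)) has_sum S) UNIV"
    by (intro has_sum_reindex_bij_witness[of _ Suc "\<lambda>n. n - 1"]) auto
  finally have "(\<lambda>n. a (Suc n)) sums S" by (rule has_sum_imp_sums)
  hence "frakF p s (principal_char p) z = S"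
    by (simp add: frakF_def a_def sums_iff)
  thus ?thesis using 1 by (simp add: D_def)
qed

lemma dirichlet_L_has_sum:
  assumes p: "prime p" and s: "s \<ge> 2"
  shows "((\<lambda>d. 1 / of_nat d ^ s) has_sum dirichlet_L (of_nat s) (principal_char p)) {d. coprime d p}"
proof -
  define S :: complex where "S = infsum (\<lambda>d. 1 / of_nat d ^ s) {d. coprime d p}"
  have "(\<lambda>d::nat. norm (1 / of_nat d ^ s :: complex)) summable_on {d. coprime d p}"
    using summable_on_inverse_power[OF s] by (simp add: norm_divide norm_power)
  from abs_summable_summable[OF this]
  have S: "((\<lambda>d. 1 / of_nat d ^ s) has_sum S) {d. coprime d p}"
    unfolding S_def by (rule has_sum_infsum)
  also have "?this \<longleftrightarrow> ((\<lambda>n. principal_char p n / of_nat n ^ s) has_sum S) {1..}"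
    using p by (intro has_sum_cong_neutral) (auto simp: principal_char_def Suc_le_eq intro!: Nat.gr0I)
  also have "\<dots> \<longleftrightarrow> ((\<lambda>n. principal_char p (Suc n) / of_nat (Suc n) ^ s) has_sum S) UNIV"
    by (intro has_sum_reindex_bij_witness[of _ Suc "\<lambda>n. n - 1"]) auto
  finally have "(\<lambda>n. principal_char p (Suc n) / of_nat (Suc n) ^ s) sums S"
    by (rule has_sum_imp_sums)
  hence "dirichlet_L (of_nat s) (principal_char p) = S"
    unfolding dirichlet_L_def by (simp add: powr_nat' sums_iff del: of_nat_Suc)
  thus ?thesis using S by simp
qed

subsection \<open>Zeta values at even integers\<close>

lemma subdegree_fps_exp_minus_1:
  assumes "c \<noteq> 0"
  shows "subdegree (fps_exp c - 1 :: 'a :: field_char_0 fps) = 1"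
  using assms by (intro subdegreeI) auto

text \<open>The defining quotient of formal series is rescaled from X to c X and then identified
  with an analytic function; the value 1 at 0 fills the removable singularity.\<close>

lemma bernoulli_has_fps_expansion:
  fixes c :: complex
  assumes c: "c \<noteq> 0"
  shows "(\<lambda>x. if x = 0 then 1 else c * x / (exp (c * x) - 1)) has_fps_expansion
           Abs_fps (\<lambda>n. c ^ n * of_real (bernoulli n / fact n))"
proof -
  define b :: "real fps" where "b = fps_X / (fps_exp 1 - 1)"
  define G where "G = Abs_fps (\<lambda>n. c ^ n * of_real (bernoulli n / fact n))"
  define E where "E = fps_exp c - 1"
  have E: "subdegree E = 1" "E \<noteq> 0"
    using subdegree_fps_exp_minus_1[OF c] by (auto simp: E_def)
  \<comment> \<open>The quotient in \<open>bernoulli\<close> is exact because numerator and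
    denominator both have subdegree 1.\<close>
  have "(fps_exp 1 - 1 :: real fps) dvd fps_X"
    using subdegree_fps_exp_minus_1[of "1::real"] by (subst fps_dvd_iff) auto
  hence b: "b * (fps_exp 1 - 1) = fps_X"
    unfolding b_def by (rule dvd_div_mult_self)
  have "G * E = fps_const c * fps_X"
  proof (rule fps_ext)
    fix n :: nat
    \<comment> \<open>Splitting c^n as c^i c^(n-i) shows that rescaling commutes with the Cauchy
      product, so the identity for \<open>b\<close> carries over to \<open>G\<close>.\<close>
    have "fps_nth (G * E) n = (\<Sum>i=0..n. c ^ n * of_real (fps_nth b i * fps_nth (fps_exp 1 - 1) (n - i)))"
      unfolding fps_mult_nth
    proof (rule sum.cong, goal_cases)
      case (2 i)
      hence "c ^ n = c ^ i * c ^ (n - i)" by (simp flip: power_add)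
      thus ?case
        by (simp add: G_def E_def b_def bernoulli_def)
    qed auto
    also have "\<dots> = c ^ n * of_real (fps_nth (b * (fps_exp 1 - 1)) n)"
      by (simp only: fps_mult_nth of_real_sum sum_distrib_left)
    also have "\<dots> = fps_nth (fps_const c * fps_X) n"
      unfolding b by (simp add: fps_X_def)
    finally show "fps_nth (G * E) n = fps_nth (fps_const c * fps_X) n" .
  qed
  hence "(fps_const c * fps_X) / E = G"
    using E by (metis nonzero_mult_div_cancel_right)
  moreover have "(\<lambda>x. if x = 0 then 1 else c * x / (exp (c * x) - 1)) has_fps_expansion
                   (fps_const c * fps_X) / E"
    unfolding E_def
  proof (intro has_fps_expansion_divide fps_expansion_intros)
    show "subdegree (fps_exp c - 1) \<le> subdegree (fps_const c * fps_X)"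
      using c E by (simp add: E_def)
    show "fps_exp c - 1 \<noteq> 0" using E by (simp add: E_def)
    show "1 = fps_nth (fps_const c * fps_X) (subdegree (fps_exp c - 1)) /
              fps_nth (fps_exp c - 1) (subdegree (fps_exp c - 1))"
      using c E by (simp add: E_def)
  qed
  ultimately show ?thesis by (simp add: G_def)
qed

text \<open>Each partial fraction, multiplied by \<open>w\<close>, equals -2 y / (1 - y) with y = (w
  / n)^2 and is a geometric series. Exchanging the sums over n and m collects the values of zeta at
  even integers; the exchange is justified by the bound 2 |w|^(2m) / n^2.\<close>

lemma pi_cot_power_series:
  fixes w :: complex
  assumes w: "norm w < 1" "w \<noteq> 0"
  shows "((\<lambda>m. -2 * (\<Sum>\<^sub>\<infinity>n\<in>{1..}. 1 / of_nat n ^ (2 * m)) * w ^ (2 * m)) has_sum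
           (of_real pi * w * cot (of_real pi * w) - 1)) {1..}"
proof -
  have wZ: "w \<notin> \<int>"
    using w by (auto elim!: Ints_cases)
  define h where "h = (\<lambda>(n, m). -2 * w ^ (2 * m) / of_nat n ^ (2 * m))"
  have lt: "norm w ^ 2 < 1" using w by (simp add: power_less_one_iff abs_square_less_1)
  have "(\<lambda>x. norm (h x)) summable_on {1..} \<times> {1..}"
  proof (rule Infinite_Sum.abs_summable_on_comparison_test')
    have "(\<lambda>m. (norm w ^ 2) ^ m) summable_on {1..}"
      using has_sum_geometric_from_1[of "norm w ^ 2"] lt by (auto simp: summable_on_def)
    hence "(\<lambda>(n, m). (1 / real n ^ 2) * (2 * (norm w ^ 2) ^ m)) summable_on {1..} \<times> {1..}"
      by (intro summable_on_times_product summable_on_inverse_power summable_on_cmult_right) auto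
    thus "(\<lambda>x. (1 / real (fst x) ^ 2) * (2 * (norm w ^ 2) ^ snd x)) summable_on {1..} \<times> {1..}"
      by (simp add: case_prod_unfold)
  next
    fix x :: "nat \<times> nat"
    assume x: "x \<in> {1..} \<times> {1..}"
    obtain n m where [simp]: "x = (n, m)" by (cases x)
    have nm: "n \<ge> 1" "m \<ge> 1" using x by auto
    have "norm (h x) = 2 * (norm w ^ 2) ^ m / real n ^ (2 * m)"
      by (simp add: h_def norm_divide norm_mult norm_power power_mult)
    also have "\<dots> \<le> 2 * (norm w ^ 2) ^ m / real n ^ 2"
      using nm by (intro divide_left_mono power_increasing mult_pos_pos) auto
    finally show "norm (h x) \<le> (1 / real (fst x) ^ 2) * (2 * (norm w ^ 2) ^ snd x)" by simp
  qed
  from abs_summable_summable[OF this] have h: "(h has_sum infsum h ({1..} \<times> {1..})) ({1..} \<times> {1..})"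
    by (rule has_sum_infsum)
  have "((\<lambda>n. w * (2 * w / (w\<^sup>2 - of_nat n ^ 2))) has_sum infsum h ({1..} \<times> {1..})) {1..}"
  proof (rule has_sum_SigmaD[OF h])
    fix n :: nat assume n: "n \<in> {1..}"
    define y where "y = w\<^sup>2 / of_nat n ^ 2"
    have "norm y \<le> norm w ^ 2 / 1"
      unfolding y_def norm_divide norm_power norm_of_nat using n
      by (intro divide_left_mono) (auto simp: Suc_le_eq one_le_power)
    hence y: "norm y < 1" using lt by simp
    hence y1: "y \<noteq> 1" by auto
    have "w\<^sup>2 = y * of_nat n ^ 2" using n by (simp add: y_def)
    hence "w * (2 * w / (w\<^sup>2 - of_nat n ^ 2)) = 2 * (y * of_nat n ^ 2) / (y * of_nat n ^ 2 - of_nat n ^ 2)"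
      by (metis power2_eq_square mult.assoc mult.left_commute times_divide_eq_right)
    also have "y * of_nat n ^ 2 - of_nat n ^ 2 = (y - 1) * of_nat n ^ 2"
      by (simp add: left_diff_distrib)
    also have "2 * (y * of_nat n ^ 2) / \<dots> = 2 * y / (y - 1)"
      using n by simp
    also have "\<dots> = -2 * (y / (1 - y))"
      using y1 by (simp add: divide_simps) (simp add: algebra_simps)
    finally have "-2 * (y / (1 - y)) = w * (2 * w / (w\<^sup>2 - of_nat n ^ 2))" ..
    moreover have "((\<lambda>m. -2 * y ^ m) has_sum (-2 * (y / (1 - y)))) {1..}"
      by (intro has_sum_cmult_right has_sum_geometric_from_1 y)
    ultimately show "((\<lambda>m. h (n, m)) has_sum w * (2 * w / (w\<^sup>2 - of_nat n ^ 2))) {1..}"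
      by (simp add: h_def y_def power_divide power_mult)
  qed
  moreover have "((\<lambda>n. w * (2 * w / (w\<^sup>2 - of_nat n ^ 2))) has_sum
                    (w * (of_real pi * cot (of_real pi * w) - 1 / w))) {1..}"
    by (intro has_sum_cmult_right cot_partial_fractions wZ)
  ultimately have "infsum h ({1..} \<times> {1..}) = w * (of_real pi * cot (of_real pi * w) - 1 / w)"
    by (rule has_sum_unique)
  also have "\<dots> = of_real pi * w * cot (of_real pi * w) - 1"
    using w by (simp add: right_diff_distrib mult_ac)
  finally have "((\<lambda>(m, n). h (n, m)) has_sum (of_real pi * w * cot (of_real pi * w) - 1)) ({1..} \<times> {1..})"
    using h by (subst (asm) has_sum_swap) simp
  thus ?thesis
  proof (rule has_sum_SigmaD)
    fix m :: nat assume m: "m \<in> {1..}"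
    have "(\<lambda>n::nat. norm (1 / of_nat n ^ (2 * m) :: complex)) summable_on {1..}"
      using summable_on_inverse_power[of "2 * m"] m by (simp add: norm_divide norm_power)
    from abs_summable_summable[OF this]
    have "((\<lambda>n. -2 * w ^ (2 * m) * (1 / of_nat n ^ (2 * m))) has_sum
            (-2 * w ^ (2 * m) * (\<Sum>\<^sub>\<infinity>n\<in>{1..}. 1 / of_nat n ^ (2 * m)))) {1..}"
      by (intro has_sum_cmult_right has_sum_infsum)
    thus "((\<lambda>n. case (m, n) of (m, n) \<Rightarrow> h (n, m)) has_sum
            (-2 * (\<Sum>\<^sub>\<infinity>n\<in>{1..}. 1 / of_nat n ^ (2 * m)) * w ^ (2 * m))) {1..}"
      by (simp add: h_def mult_ac)
  qed
qed

text \<open>The function pi w cot(pi w) has two expansions at 0, one with zeta values and one with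
  Bernoulli numbers; the coefficients of w^(2m) are compared.\<close>

lemma zeta_even:
  assumes m: "m \<ge> 1"
  shows "((\<lambda>n. 1 / of_nat n ^ (2 * m)) has_sum
           (- ((2 * of_real pi * \<i>) ^ (2 * m) * (of_real (bernoulli (2 * m)) / fact (2 * m)) / 2))) {1..}"
proof -
  define \<zeta> :: "nat \<Rightarrow> complex" where "\<zeta> = (\<lambda>m. \<Sum>\<^sub>\<infinity>n\<in>{1..}. 1 / of_nat n ^ m)"
  define c where "c = 2 * of_real pi * \<i>"
  \<comment> \<open>On the unit disc this is pi w cot(pi w), continued by 1 at the origin. The
    summand i pi w enters only the coefficient of index 1 and so does not disturb the even
    ones.\<close>
  define f where "f = (\<lambda>w. \<i> * of_real pi * w + (if w = 0 then 1 else c * w / (exp (c * w) - 1)))"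
  define G where "G = fps_const (\<i> * of_real pi) * fps_X + Abs_fps (\<lambda>n. c ^ n * of_real (bernoulli n / fact n))"
  define F where "F = Abs_fps (\<lambda>n. if n = 0 then 1 else if even n then -2 * \<zeta> n else 0)"
  have "c \<noteq> 0" by (simp add: c_def)
  hence G: "f has_fps_expansion G"
    unfolding f_def G_def by (intro fps_expansion_intros bernoulli_has_fps_expansion)
  have "(\<lambda>n. fps_nth F n * w ^ n) sums f w" if w: "norm w < 1" for w
  proof (cases "w = 0")
    case True
    thus ?thesis using powser_sums_zero[of "fps_nth F"] by (simp add: F_def f_def)
  next
    case False
    have "w \<notin> \<int>" using w False by (auto elim!: Ints_cases)
    from cot_conv_exp[OF this] have f: "f w = of_real pi * w * cot (of_real pi * w)"
      using False by (simp add: f_def c_def) (simp add: divide_simps, simp add: algebra_simps)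
    have "((\<lambda>m. -2 * \<zeta> (2 * m) * w ^ (2 * m)) has_sum (f w - 1)) {1..}"
      unfolding \<zeta>_def f by (rule pi_cot_power_series[OF w False])
    also have "?this \<longleftrightarrow> ((\<lambda>n. fps_nth F n * w ^ n) has_sum (f w - 1)) {n \<in> {1..}. even n}"
      by (intro has_sum_reindex_bij_witness[of _ "\<lambda>n. n div 2" "\<lambda>n. 2 * n"]) (auto simp: F_def elim!: evenE)
    also have "\<dots> \<longleftrightarrow> ((\<lambda>n. fps_nth F n * w ^ n) has_sum (f w - 1)) {1..}"
      by (intro has_sum_cong_neutral) (auto simp: F_def)
    finally have "((\<lambda>n. fps_nth F n * w ^ n) has_sum (fps_nth F 0 * w ^ 0 + (f w - 1))) (insert 0 {1..})"
      by (intro has_sum_insert) auto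
    also have "insert 0 {1..} = (UNIV :: nat set)" by auto
    finally have "((\<lambda>n. fps_nth F n * w ^ n) has_sum f w) UNIV" by (simp add: F_def)
    thus ?thesis by (rule has_sum_imp_sums)
  qed
  moreover have "eventually (\<lambda>w. w \<in> ball 0 1) (nhds (0::complex))"
    by (intro eventually_nhds_in_open) auto
  ultimately have F: "f has_fps_expansion F"
    by (intro has_fps_expansionI) (auto elim!: eventually_mono)
  have "fps_nth F (2 * m) = fps_nth G (2 * m)"
    using fps_nth_fps_expansion[OF F] fps_nth_fps_expansion[OF G] by simp
  hence "-2 * \<zeta> (2 * m) = c ^ (2 * m) * (of_real (bernoulli (2 * m)) / fact (2 * m))"
    using m by (simp add: F_def G_def fps_X_def)
  hence "\<zeta> (2 * m) = - (c ^ (2 * m) * (of_real (bernoulli (2 * m)) / fact (2 * m)) / 2)"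
    by (metis minus_divide_left minus_minus mult_minus_left nonzero_mult_div_cancel_left zero_neq_numeral)
  moreover have "(\<lambda>n::nat. norm (1 / of_nat n ^ (2 * m) :: complex)) summable_on {1..}"
    using summable_on_inverse_power[of "2 * m"] m by (simp add: norm_divide norm_power)
  from has_sum_infsum[OF abs_summable_summable[OF this]]
  have "((\<lambda>n. 1 / of_nat n ^ (2 * m)) has_sum \<zeta> (2 * m)) {1..}"
    by (simp add: \<zeta>_def)
  ultimately show ?thesis by (simp only: c_def)
qed

text \<open>The multiples of \<open>p\<close> contribute p^(-2m) times the full sum; removing them
  yields the Euler factor 1 - p^(-2m).\<close>

lemma zeta_even_coprime:
  assumes p: "prime p" and m: "m \<ge> 1"
  shows "((\<lambda>n. 1 / of_nat n ^ (2 * m)) has_sum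
           (- ((2 * of_real pi * \<i>) ^ (2 * m) * (of_nat p ^ (2 * m) - 1) / of_nat p ^ (2 * m)
               * (of_real (bernoulli (2 * m)) / fact (2 * m)) / 2))) {n. coprime n p}"
proof -
  define f :: "nat \<Rightarrow> complex" where "f = (\<lambda>n. 1 / of_nat n ^ (2 * m))"
  define Z where "Z = - ((2 * of_real pi * \<i>) ^ (2 * m) * (of_real (bernoulli (2 * m)) / fact (2 * m)) / 2)"
  have p0: "p > 0" using p by (simp add: prime_gt_0_nat)
  have 1: "(f has_sum Z) {1..}"
    using zeta_even[OF m] by (simp add: f_def Z_def)
  hence "((\<lambda>n. f n / of_nat p ^ (2 * m)) has_sum (Z / of_nat p ^ (2 * m))) {1..}"
    by (rule has_sum_divide_const)
  also have "?this \<longleftrightarrow> (f has_sum (Z / of_nat p ^ (2 * m))) {n \<in> {1..}. p dvd n}"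
    by (intro has_sum_reindex_bij_witness[of _ "\<lambda>n. n div p" "\<lambda>n. p * n"])
       (use p0 in \<open>auto elim!: dvdE simp: f_def power_mult_distrib\<close>)
  finally have "(f has_sum (Z - Z / of_nat p ^ (2 * m))) ({1..} - {n \<in> {1..}. p dvd n})"
    by (intro has_sum_Diff 1) auto
  also have "{1..} - {n \<in> {1..}. p dvd n} = {n. coprime n p}"
    using p by (auto simp: coprime_prime_iff Suc_le_eq intro!: Nat.gr0I)
  also have "Z - Z / of_nat p ^ (2 * m) = - ((2 * of_real pi * \<i>) ^ (2 * m) * (of_nat p ^ (2 * m) - 1) / of_nat p ^ (2 * m)
               * (of_real (bernoulli (2 * m)) / fact (2 * m)) / 2)"
    using p0 by (simp add: Z_def divide_simps) (simp add: algebra_simps)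
  finally show ?thesis by (simp only: f_def)
qed

subsection \<open>The double sum and its transformation\<close>

text \<open>Unconditional summability of complex families is absolute, so the nonnegative case
  applies to the norms.\<close>

lemma has_sum_product:
  fixes f :: "'a \<Rightarrow> complex" and g :: "'b \<Rightarrow> complex"
  assumes f: "(f has_sum F) A" and g: "(g has_sum G) B"
  shows "((\<lambda>(x, y). f x * g y) has_sum F * G) (A \<times> B)"
proof (rule has_sum_SigmaI)
  show "((\<lambda>y. case (x, y) of (x, y) \<Rightarrow> f x * g y) has_sum f x * G) B" for x
    using has_sum_cmult_right[OF g] by simp
  show "((\<lambda>x. f x * G) has_sum F * G) A"
    by (rule has_sum_cmult_left[OF f])
  have "(\<lambda>(x, y). norm (f x) * norm (g y)) summable_on A \<times> B"
    using has_sum_imp_summable[OF f] has_sum_imp_summable[OF g]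
    by (intro summable_on_times_product) (simp_all add: summable_on_iff_abs_summable_on_complex)
  hence "(\<lambda>x. norm (case x of (x, y) \<Rightarrow> f x * g y)) summable_on A \<times> B"
    by (simp add: case_prod_unfold norm_mult)
  thus "(\<lambda>(x, y). f x * g y) summable_on A \<times> B"
    by (rule abs_summable_summable)
qed

lemma has_sum_sum:
  fixes f :: "'i \<Rightarrow> 'a \<Rightarrow> 'b :: topological_comm_monoid_add"
  assumes "\<And>i. i \<in> I \<Longrightarrow> (f i has_sum s i) A"
  shows "((\<lambda>x. \<Sum>i\<in>I. f i x) has_sum (\<Sum>i\<in>I. s i)) A"
  using assms
proof (induction I rule: infinite_finite_induct)
  case (insert i I)
  thus ?case by (simp add: has_sum_add)
qed auto

text \<open>After multiplication by the conjugate of \<open>\<tau>\<close> the \<open>x\<close> term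
  is real, so the imaginary part only sees \<open>y\<close>. The resulting bound is uniform in
  \<open>x\<close>.\<close>

lemma norm_lattice_ge:
  fixes \<tau> :: complex and x y :: real
  assumes "Im \<tau> > 0"
  shows "Im \<tau> / norm \<tau> * \<bar>y\<bar> \<le> norm (\<tau> * of_real x + of_real y)"
proof -
  have t: "norm \<tau> > 0" using assms by auto
  have "\<bar>y\<bar> * Im \<tau> = \<bar>Im ((\<tau> * of_real x + of_real y) * cnj \<tau>)\<bar>"
    using assms by (simp add: algebra_simps abs_mult)
  also have "\<dots> \<le> norm ((\<tau> * of_real x + of_real y) * cnj \<tau>)"
    by (rule abs_Im_le_cmod)
  also have "\<dots> = norm (\<tau> * of_real x + of_real y) * norm \<tau>"
    by (simp add: norm_mult)
  finally show ?thesis using t by (simp add: field_simps)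
qed

text \<open>The quadratic form factors as (\<open>\<tau>\<close> x + y)(\<open>\<tau>\<close> x -
  y), and each factor obeys \<open>norm_lattice_ge\<close>. Uniformity in \<open>x\<close> separates
  the two summation variables later, and the bound shows that the denominators do not vanish for
  nonzero \<open>y\<close>.\<close>

lemma norm_quadratic_ge:
  fixes \<tau> :: complex and x y :: real
  assumes "Im \<tau> > 0"
  shows "(Im \<tau> / norm \<tau>)\<^sup>2 * y\<^sup>2 \<le> norm ((\<tau> * of_real x)\<^sup>2 - of_real y ^ 2)"
proof -
  have "(Im \<tau> / norm \<tau>)\<^sup>2 * y\<^sup>2 = (Im \<tau> / norm \<tau> * \<bar>y\<bar>) * (Im \<tau> / norm \<tau> * \<bar>- y\<bar>)"
    by (simp add: power2_eq_square)
  also have "\<dots> \<le> norm (\<tau> * of_real x + of_real y) * norm (\<tau> * of_real x + of_real (- y))"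
    using assms by (intro mult_mono norm_lattice_ge) auto
  also have "\<dots> = norm ((\<tau> * of_real x)\<^sup>2 - of_real y ^ 2)"
    by (simp add: norm_mult [symmetric] power2_eq_square algebra_simps)
  finally show ?thesis .
qed

lemma quadratic_double_sum_summable:
  fixes \<tau> :: complex and k :: nat and A B :: "nat set"
  assumes \<tau>: "Im \<tau> > 0" and k: "k \<ge> 1" and B: "0 \<notin> B"
  shows "(\<lambda>(d, n). 1 / (of_nat d ^ (2 * k) * ((\<tau> * of_nat d)\<^sup>2 - of_nat n ^ 2))) summable_on A \<times> B"
proof (rule abs_summable_summable, rule Infinite_Sum.abs_summable_on_comparison_test')
  define c where "c = (Im \<tau> / norm \<tau>)\<^sup>2"
  have c: "c > 0" using \<tau> by (auto simp: c_def)
  have "(\<lambda>(d, n). (1 / real d ^ (2 * k)) * (1 / c * (1 / real n ^ 2))) summable_on A \<times> B"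
    using c k by (intro summable_on_times_product summable_on_inverse_power summable_on_cmult_right) auto
  thus "(\<lambda>x. (1 / real (fst x) ^ (2 * k)) * (1 / c * (1 / real (snd x) ^ 2))) summable_on A \<times> B"
    by (simp add: case_prod_unfold)
  fix x assume x: "x \<in> A \<times> B"
  obtain d n where [simp]: "x = (d, n)" by (cases x)
  have n: "n > 0" using x B by (auto intro!: Nat.gr0I)
  have le: "c * real n ^ 2 \<le> norm ((\<tau> * of_nat d)\<^sup>2 - of_nat n ^ 2)"
    using norm_quadratic_ge[OF \<tau>, of n d] by (simp add: c_def)
  have pos: "0 < c * real n ^ 2" using c n by simp
  have "norm (1 / (of_nat d ^ (2 * k) * ((\<tau> * of_nat d)\<^sup>2 - of_nat n ^ 2))) =
        1 / real d ^ (2 * k) * (1 / norm ((\<tau> * of_nat d)\<^sup>2 - of_nat n ^ 2))"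
    by (simp add: norm_divide norm_mult norm_power)
  also have "\<dots> \<le> 1 / real d ^ (2 * k) * (1 / (c * real n ^ 2))"
    using c n pos less_le_trans[OF pos le] le by (intro mult_left_mono divide_left_mono mult_pos_pos) simp_all
  finally show "norm (case x of (d, n) \<Rightarrow> 1 / (of_nat d ^ (2 * k) * ((\<tau> * of_nat d)\<^sup>2 - of_nat n ^ 2)))
            \<le> (1 / real (fst x) ^ (2 * k)) * (1 / c * (1 / real (snd x) ^ 2))"
    by simp
qed

text \<open>Summing the double series over n first gives, for each d, a difference of cotangents at
  \<open>of_nat d * z\<close>; this is matched with \<open>frakF_has_sum\<close>, whose constant
  part contributes the L-value.\<close>

lemma frakF_conv_double_sum:
  fixes p k :: nat and z :: complex
  assumes p: "prime p" and k: "k \<ge> 1" and z: "Im z > 0"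
  assumes X: "((\<lambda>(d, n). 1 / (of_nat d ^ (2 * k) * ((of_nat p * z * of_nat d)\<^sup>2 - of_nat n ^ 2)))
                has_sum X) ({d. coprime d p} \<times> {n. coprime n p})"
  shows "frakF p (2 * k + 1) (principal_char p) z =
           (of_nat p - 1) / 2 * dirichlet_L (of_nat (2 * k + 1)) (principal_char p)
           - \<i> * of_nat p * (of_nat p * z) / of_real pi * X"
proof -
  define C :: "complex \<Rightarrow> complex" where "C = (\<lambda>w. of_nat p * cot (of_real pi * (of_nat p * w)) - cot (of_real pi * w))"
  have p0: "p > 0" using p by (simp add: prime_gt_0_nat)
  have z0: "z \<noteq> 0" using z by auto
  have d0: "d > 0" if "coprime d p" for d
    using that p by (auto intro!: Nat.gr0I)
  have "((\<lambda>d. of_real pi * C (of_nat d * z) / (2 * of_nat p ^ 2 * z * of_nat d ^ (2 * k + 1))) has_sum X)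
          {d. coprime d p}"
  proof (rule has_sum_SigmaD[OF X])
    fix d assume d: "d \<in> {d. coprime d p}"
    have "((\<lambda>n. 2 * of_nat p ^ 2 * (of_nat d * z) / ((of_nat p * (of_nat d * z))\<^sup>2 - of_nat n ^ 2)
              / (2 * of_nat p ^ 2 * z * of_nat d ^ (2 * k + 1))) has_sum
            (of_real pi * C (of_nat d * z) / (2 * of_nat p ^ 2 * z * of_nat d ^ (2 * k + 1)))) {n. coprime n p}"
      unfolding C_def using d d0[of d] z by (intro has_sum_divide_const cot_diff_partial_fractions p) auto
    also have "(\<lambda>n. 2 * of_nat p ^ 2 * (of_nat d * z) / ((of_nat p * (of_nat d * z))\<^sup>2 - of_nat n ^ 2)
              / (2 * of_nat p ^ 2 * z * of_nat d ^ (2 * k + 1))) =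
          (\<lambda>n. 1 / (of_nat d ^ (2 * k) * ((of_nat p * z * of_nat d)\<^sup>2 - of_nat n ^ 2)))"
      using p0 z0 d d0[of d] by (simp add: mult_ac)
    finally show "((\<lambda>n. case (d, n) of (d, n) \<Rightarrow>
            1 / (of_nat d ^ (2 * k) * ((of_nat p * z * of_nat d)\<^sup>2 - of_nat n ^ 2))) has_sum
            (of_real pi * C (of_nat d * z) / (2 * of_nat p ^ 2 * z * of_nat d ^ (2 * k + 1)))) {n. coprime n p}"
      by simp
  qed
  \<comment> \<open>The factor -i p (p z) / pi turns pi / (2 p^2 z) into -i / 2, the coefficient of
    \<open>C\<close> in the cotangent form of \<open>frakF\<close>.\<close>
  hence "((\<lambda>d. (of_nat p - 1) / 2 * (1 / of_nat d ^ (2 * k + 1)) + (- (\<i> * of_nat p * (of_nat p * z) / of_real pi)) *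
             (of_real pi * C (of_nat d * z) / (2 * of_nat p ^ 2 * z * of_nat d ^ (2 * k + 1)))) has_sum
          ((of_nat p - 1) / 2 * dirichlet_L (of_nat (2 * k + 1)) (principal_char p)
           + (- (\<i> * of_nat p * (of_nat p * z) / of_real pi)) * X)) {d. coprime d p}"
    using k by (intro has_sum_add has_sum_cmult_right dirichlet_L_has_sum p) auto
  also have "(\<lambda>d. (of_nat p - 1) / 2 * (1 / of_nat d ^ (2 * k + 1)) + (- (\<i> * of_nat p * (of_nat p * z) / of_real pi)) *
             (of_real pi * C (of_nat d * z) / (2 * of_nat p ^ 2 * z * of_nat d ^ (2 * k + 1)))) =
             (\<lambda>d. ((of_nat p - 1) / 2 + \<i> / 2 * (- C (of_nat d * z))) / of_nat d ^ (2 * k + 1))"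
    using p0 z0 by (simp add: fun_eq_iff add_divide_distrib diff_divide_distrib power2_eq_square)
  also have "\<dots> = (\<lambda>d. ((of_nat p - 1) / 2 + \<i> / 2 * (cot (of_real pi * (of_nat d * z))
             - of_nat p * cot (of_real pi * (of_nat p * (of_nat d * z))))) / of_nat d ^ (2 * k + 1))"
    by (simp only: C_def minus_diff_eq)
  finally have "((\<lambda>d. ((of_nat p - 1) / 2 + \<i> / 2 * (cot (of_real pi * (of_nat d * z))
             - of_nat p * cot (of_real pi * (of_nat p * (of_nat d * z))))) / of_nat d ^ (2 * k + 1)) has_sum
          ((of_nat p - 1) / 2 * dirichlet_L (of_nat (2 * k + 1)) (principal_char p)
           + (- (\<i> * of_nat p * (of_nat p * z) / of_real pi)) * X)) {d. coprime d p}" .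
  moreover have "((\<lambda>d. ((of_nat p - 1) / 2 + \<i> / 2 * (cot (of_real pi * (of_nat d * z))
             - of_nat p * cot (of_real pi * (of_nat p * (of_nat d * z))))) / of_nat d ^ (2 * k + 1))
           has_sum frakF p (2 * k + 1) (principal_char p) z) {d. coprime d p}"
    using k by (intro frakF_has_sum p z) auto
  ultimately have "frakF p (2 * k + 1) (principal_char p) z =
      (of_nat p - 1) / 2 * dirichlet_L (of_nat (2 * k + 1)) (principal_char p)
           + (- (\<i> * of_nat p * (of_nat p * z) / of_real pi)) * X"
    using has_sum_unique by blast
  thus ?thesis by simp
qed

text \<open>Replacing \<open>\<tau>\<close> by -1 / \<open>\<tau>\<close> and exchanging d and n
  changes the denominator Q = (\<open>\<tau>\<close> d)^2 - n^2 into -Q / \<open>\<tau>\<close>^2.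
  Over the common denominator the numerator is thus a multiple of (\<open>\<tau>\<close> d)^(2k) -
  n^(2k), which Q divides with a finite geometric sum as quotient.\<close>

lemma quadratic_sum_term_identity:
  fixes \<tau> d n :: complex
  assumes "\<tau> \<noteq> 0" "d \<noteq> 0" "n \<noteq> 0" "(\<tau> * d)\<^sup>2 - n\<^sup>2 \<noteq> 0"
  shows "\<tau> ^ (2 * k) / \<tau> * (1 / (n ^ (2 * k) * ((- 1 / \<tau> * n)\<^sup>2 - d\<^sup>2)))
           + \<tau> * (1 / (d ^ (2 * k) * ((\<tau> * d)\<^sup>2 - n\<^sup>2)))
         = (\<Sum>j = 1..k. - \<tau> * \<tau> ^ (2 * k - 2 * j) * ((1 / d ^ (2 * j)) * (1 / n ^ (2 * k + 2 - 2 * j))))"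
proof -
  define Q where "Q = (\<tau> * d)\<^sup>2 - n\<^sup>2"
  have Q: "Q \<noteq> 0" using assms by (simp add: Q_def)
  have "(- 1 / \<tau> * n)\<^sup>2 - d\<^sup>2 = - (Q / \<tau>\<^sup>2)"
    using assms by (simp add: Q_def field_simps power2_eq_square)
  hence "\<tau> ^ (2 * k) / \<tau> * (1 / (n ^ (2 * k) * ((- 1 / \<tau> * n)\<^sup>2 - d\<^sup>2)))
           + \<tau> * (1 / (d ^ (2 * k) * ((\<tau> * d)\<^sup>2 - n\<^sup>2)))
         = - (\<tau> ^ (2 * k) / \<tau> * (\<tau>\<^sup>2 / (n ^ (2 * k) * Q))) + \<tau> / (d ^ (2 * k) * Q)"
    by (simp add: Q_def)
  also have "\<dots> = - \<tau> * ((((\<tau> * d)\<^sup>2) ^ k - (n\<^sup>2) ^ k) / (d ^ (2 * k) * n ^ (2 * k) * Q))"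
    using assms Q
    by (simp add: power_mult_distrib power_mult [symmetric] divide_simps) (simp add: algebra_simps power2_eq_square)
  also have "((\<tau> * d)\<^sup>2) ^ k - (n\<^sup>2) ^ k = Q * (\<Sum>i<k. (n\<^sup>2) ^ (k - Suc i) * ((\<tau> * d)\<^sup>2) ^ i)"
    unfolding Q_def by (rule power_diff_sumr2)
  also have "- \<tau> * (Q * (\<Sum>i<k. (n\<^sup>2) ^ (k - Suc i) * ((\<tau> * d)\<^sup>2) ^ i) / (d ^ (2 * k) * n ^ (2 * k) * Q)) =
             - \<tau> * ((\<Sum>i<k. (n\<^sup>2) ^ (k - Suc i) * ((\<tau> * d)\<^sup>2) ^ i) / (d ^ (2 * k) * n ^ (2 * k)))"
    using Q by simp
  also have "\<dots> = (\<Sum>i<k. - \<tau> * ((n\<^sup>2) ^ (k - Suc i) * ((\<tau> * d)\<^sup>2) ^ i / (d ^ (2 * k) * n ^ (2 * k))))"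
    by (simp only: sum_divide_distrib sum_distrib_left)
  also have "\<dots> = (\<Sum>j = 1..k. - \<tau> * \<tau> ^ (2 * k - 2 * j) * ((1 / d ^ (2 * j)) * (1 / n ^ (2 * k + 2 - 2 * j))))"
  \<comment> \<open>With j = k - i the surviving exponents are 2j for d and 2(i + 1) = 2k + 2 - 2j
    for n.\<close>
  proof (rule sum.reindex_bij_witness[of _ "\<lambda>j. k - j" "\<lambda>i. k - i"], goal_cases)
    case (5 i)
    have "2 * k = 2 * i + 2 * (k - i)" "2 * k = 2 * (k - Suc i) + 2 * Suc i" using 5 by auto
    hence d: "d ^ (2 * k) = d ^ (2 * i) * d ^ (2 * (k - i))"
      and n: "n ^ (2 * k) = n ^ (2 * (k - Suc i)) * n ^ (2 * Suc i)"
      by (metis power_add)+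
    have e: "2 * k - 2 * (k - i) = 2 * i" "2 * k + 2 - 2 * (k - i) = 2 * Suc i" using 5 by auto
    show ?case unfolding e d n using assms
      by (simp add: power_mult_distrib power_mult [symmetric] del: mult_Suc_right power_Suc)
  qed auto
  finally show ?thesis .
qed

theorem theorem4:
  fixes p k :: nat and z :: complex
  assumes "prime p" and "k \<ge> 1" and "Im z > 0"
  shows "(z * of_nat p) ^ (2 * k)
           * frakF p (2 * k + 1) (principal_char p) (- 1 / (of_nat p ^ 2 * z))
         - frakF p (2 * k + 1) (principal_char p) z
       = (of_nat p - 1) / 2 * dirichlet_L (of_nat (2 * k + 1)) (principal_char p)
           * ((z * of_nat p) ^ (2 * k) - 1)
         + (2 * of_real pi * \<i>) ^ (2 * k + 1) / (2 * z * of_nat p ^ (2 * k + 2))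
           * (\<Sum>j = 1..k. (of_nat p ^ (2 * j) - 1) * (of_nat p ^ (2 * k + 2 - 2 * j) - 1)
                * (of_real (bernoulli (2 * j)) / fact (2 * j))
                * (of_real (bernoulli (2 * k + 2 - 2 * j)) / fact (2 * k + 2 - 2 * j))
                * (of_nat p * z) ^ (2 * k + 2 - 2 * j))"
proof -
  define \<tau> where "\<tau> = of_nat p * z"
  define z' where "z' = - 1 / (of_nat p ^ 2 * z)"
  define D where "D = {d. coprime d p}"
  define P where "P = (of_nat p :: complex)"
  define L where "L = dirichlet_L (of_nat (2 * k + 1)) (principal_char p)"
  define b where "b = (\<lambda>n. complex_of_real (bernoulli n) / fact n)"
  define c where "c = 2 * of_real pi * \<i>"
  define g where "g = (\<lambda>\<tau> (d, n). 1 / (of_nat d ^ (2 * k) * ((\<tau> * of_nat d)\<^sup>2 - of_nat n ^ 2)) :: complex)"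
  define X where "X = (\<lambda>\<tau>. infsum (g \<tau>) (D \<times> D))"
  have P: "P \<noteq> 0" and p0: "p > 0" using assms(1) by (auto simp: P_def prime_gt_0_nat)
  have \<tau>: "Im \<tau> > 0" "\<tau> \<noteq> 0" and z0: "z \<noteq> 0" using assms(3) p0 by (auto simp: \<tau>_def)
  have D0: "0 \<notin> D" using assms(1) by (auto simp: D_def)
  \<comment> \<open>In the variable \<open>\<tau>\<close> the substitution of the theorem is the
    standard inversion.\<close>
  have \<tau>': "of_nat p * z' = - 1 / \<tau>"
    using p0 z0 by (simp add: z'_def \<tau>_def power2_eq_square)
  have Im_\<tau>': "Im (- 1 / \<tau>) > 0"
    using \<tau> by (simp add: Im_divide sum_power2_gt_zero_iff complex_eq_iff) 
  have "Im (of_nat p * z') > 0" using Im_\<tau>' by (simp only: \<tau>')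
  hence z': "Im z' > 0" using p0 by (simp add: zero_less_mult_iff)
  have X: "(g t has_sum X t) (D \<times> D)" if "Im t > 0" for t
    unfolding X_def g_def using that assms(2) D0
    by (intro has_sum_infsum quadratic_double_sum_summable)
  have F: "frakF p (2 * k + 1) (principal_char p) z = (P - 1) / 2 * L - \<i> * P * \<tau> / of_real pi * X \<tau>"
    using frakF_conv_double_sum[OF assms(1,2,3), of "X \<tau>"] X[OF \<tau>(1)]
    by (simp only: P_def L_def \<tau>_def g_def D_def)
  have F': "frakF p (2 * k + 1) (principal_char p) z' =
              (P - 1) / 2 * L - \<i> * P * (- 1 / \<tau>) / of_real pi * X (- 1 / \<tau>)"
    using frakF_conv_double_sum[OF assms(1,2) z', of "X (- 1 / \<tau>)"] X[OF Im_\<tau>']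
    by (simp only: P_def L_def \<tau>' g_def D_def)
  \<comment> \<open>For even m >= 2 this is the value of the sum of n^(-m) over n prime to
    \<open>p\<close>, from \<open>zeta_even_coprime\<close>.\<close>
  define Z where "Z = (\<lambda>m. - (c ^ m * (P ^ m - 1) / P ^ m * b m / 2))"
  have Z: "((\<lambda>n. 1 / of_nat n ^ m) has_sum Z m) D" if "even m" "m > 0" for m
    using that zeta_even_coprime[OF assms(1), of "m div 2"]
    by (auto simp: Z_def D_def c_def b_def P_def elim!: evenE)
  \<comment> \<open>The weights are those with which the two double sums enter the difference of the
    theorem, up to the common factor i P / pi. The sum at -1 / \<open>\<tau>\<close> is transposed
    so that \<open>quadratic_sum_term_identity\<close> applies pair by pair.\<close>
  have "((\<lambda>x. \<tau> ^ (2 * k) / \<tau> * (case x of (d, n) \<Rightarrow> g (- 1 / \<tau>) (n, d)) + \<tau> * g \<tau> x) has_sum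
          (\<tau> ^ (2 * k) / \<tau> * X (- 1 / \<tau>) + \<tau> * X \<tau>)) (D \<times> D)"
    using X[OF Im_\<tau>'] by (intro has_sum_add has_sum_cmult_right X \<tau>) (subst (asm) has_sum_swap)
  also have "?this \<longleftrightarrow> ((\<lambda>x. \<Sum>j = 1..k. - \<tau> * \<tau> ^ (2 * k - 2 * j) *
          (case x of (d, n) \<Rightarrow> (1 / of_nat d ^ (2 * j)) * (1 / of_nat n ^ (2 * k + 2 - 2 * j)))) has_sum
          (\<tau> ^ (2 * k) / \<tau> * X (- 1 / \<tau>) + \<tau> * X \<tau>)) (D \<times> D)"
  proof (rule has_sum_cong)
    fix x assume x: "x \<in> D \<times> D"
    obtain d n where [simp]: "x = (d, n)" by (cases x)
    have dn: "d > 0" "n > 0" using x D0 by (auto intro!: Nat.gr0I)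
    have "0 < (Im \<tau> / norm \<tau>)\<^sup>2 * (real n)\<^sup>2" using dn \<tau> by simp
    also have "\<dots> \<le> norm ((\<tau> * of_nat d)\<^sup>2 - of_nat n ^ 2)"
      using norm_quadratic_ge[OF \<tau>(1), of n d] by simp
    finally have "(\<tau> * of_nat d)\<^sup>2 - of_nat n ^ 2 \<noteq> 0" by auto
    from quadratic_sum_term_identity[OF \<tau>(2) _ _ this, of k] dn
    show "\<tau> ^ (2 * k) / \<tau> * (case x of (d, n) \<Rightarrow> g (- 1 / \<tau>) (n, d)) + \<tau> * g \<tau> x =
          (\<Sum>j = 1..k. - \<tau> * \<tau> ^ (2 * k - 2 * j) *
             (case x of (d, n) \<Rightarrow> (1 / of_nat d ^ (2 * j)) * (1 / of_nat n ^ (2 * k + 2 - 2 * j))))"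
      unfolding g_def \<open>x = (d, n)\<close> split by simp
  qed
  finally have 1: "((\<lambda>x. \<Sum>j = 1..k. - \<tau> * \<tau> ^ (2 * k - 2 * j) *
          (case x of (d, n) \<Rightarrow> (1 / of_nat d ^ (2 * j)) * (1 / of_nat n ^ (2 * k + 2 - 2 * j)))) has_sum
          (\<tau> ^ (2 * k) / \<tau> * X (- 1 / \<tau>) + \<tau> * X \<tau>)) (D \<times> D)" .
  \<comment> \<open>The summand is now a finite combination of products of a function of d and a
    function of n, so the double sum factors into values of \<open>Z\<close>.\<close>
  have 2: "((\<lambda>x. \<Sum>j = 1..k. - \<tau> * \<tau> ^ (2 * k - 2 * j) *
          (case x of (d, n) \<Rightarrow> (1 / of_nat d ^ (2 * j)) * (1 / of_nat n ^ (2 * k + 2 - 2 * j)))) has_sum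
          (\<Sum>j = 1..k. - \<tau> * \<tau> ^ (2 * k - 2 * j) * (Z (2 * j) * Z (2 * k + 2 - 2 * j)))) (D \<times> D)"
    by (intro has_sum_sum has_sum_cmult_right has_sum_product Z) auto
  have "(\<i> * P / of_real pi) * (\<tau> ^ (2 * k) / \<tau> * X (- 1 / \<tau>) + \<tau> * X \<tau>) =
        (\<Sum>j = 1..k. (\<i> * P / of_real pi) * (- \<tau> * \<tau> ^ (2 * k - 2 * j) * (Z (2 * j) * Z (2 * k + 2 - 2 * j))))"
    using has_sum_unique[OF 1 2] by (simp only: sum_distrib_left)
  also have "\<dots> = (\<Sum>j = 1..k. c ^ (2 * k + 1) / (2 * z * P ^ (2 * k + 2)) *
        ((P ^ (2 * j) - 1) * (P ^ (2 * k + 2 - 2 * j) - 1) * b (2 * j) * b (2 * k + 2 - 2 * j)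
            * \<tau> ^ (2 * k + 2 - 2 * j)))"
  proof (rule sum.cong[OF refl])
    fix j assume j: "j \<in> {1..k}"
    define m where "m = 2 * k + 2 - 2 * j"
    have km: "2 * k + 2 = 2 * j + m" using j by (simp add: m_def)
    \<comment> \<open>The exponents add up to 2k + 2; the surplus factor 2 pi i absorbs the
      prefactor -i / pi and leaves 2.\<close>
    have c_eq: "c ^ (2 * k + 1) * (2 * of_real pi * \<i>) = c ^ (2 * j) * c ^ m"
      unfolding c_def [symmetric] power_add [symmetric] km [symmetric] by simp
    have P_eq: "P ^ (2 * k + 2) = P ^ (2 * j) * P ^ m"
      unfolding km power_add ..
    \<comment> \<open>One of the two extra factors \<open>\<tau>\<close> is written as P z, which
      accounts for the 1 / z in the final prefactor.\<close>
    have "m = 2 * k - 2 * j + 2" using j by (auto simp: m_def)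
    hence \<tau>_eq: "\<tau> ^ m = \<tau> ^ (2 * k - 2 * j) * (P * z) * \<tau>"
      by (simp add: power_add power2_eq_square \<tau>_def P_def)
    define U where "U = (P ^ (2 * j) - 1) * (P ^ m - 1) * b (2 * j) * b m * \<tau> ^ (2 * k - 2 * j) * \<tau>"
    have "(\<i> * P / of_real pi) * (- \<tau> * \<tau> ^ (2 * k - 2 * j) * (Z (2 * j) * Z m)) =
          - (\<i> * P / of_real pi) * (c ^ (2 * j) * c ^ m) * U / (4 * (P ^ (2 * j) * P ^ m))"
      by (simp add: Z_def U_def)
    also have "\<dots> = c ^ (2 * k + 1) * P * U / (2 * P ^ (2 * k + 2))"
      unfolding c_eq [symmetric] P_eq [symmetric] by simp
    also have "\<dots> = c ^ (2 * k + 1) / (2 * z * P ^ (2 * k + 2)) *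
        ((P ^ (2 * j) - 1) * (P ^ m - 1) * b (2 * j) * b m * \<tau> ^ m)"
      unfolding \<tau>_eq U_def using z0 by simp
    finally show "(\<i> * P / of_real pi) * (- \<tau> * \<tau> ^ (2 * k - 2 * j) * (Z (2 * j) * Z (2 * k + 2 - 2 * j))) =
        c ^ (2 * k + 1) / (2 * z * P ^ (2 * k + 2)) *
        ((P ^ (2 * j) - 1) * (P ^ (2 * k + 2 - 2 * j) - 1) * b (2 * j) * b (2 * k + 2 - 2 * j)
            * \<tau> ^ (2 * k + 2 - 2 * j))"
      by (simp only: m_def)
  qed
  finally have 3: "(\<i> * P / of_real pi) * (\<tau> ^ (2 * k) / \<tau> * X (- 1 / \<tau>) + \<tau> * X \<tau>) =
      c ^ (2 * k + 1) / (2 * z * P ^ (2 * k + 2)) *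
        (\<Sum>j = 1..k. (P ^ (2 * j) - 1) * (P ^ (2 * k + 2 - 2 * j) - 1) * b (2 * j) * b (2 * k + 2 - 2 * j)
            * \<tau> ^ (2 * k + 2 - 2 * j))"
    by (simp only: sum_distrib_left)
  define A where "A = (P - 1) / 2 * L"
  have "\<tau> ^ (2 * k) * frakF p (2 * k + 1) (principal_char p) z' - frakF p (2 * k + 1) (principal_char p) z =
        (P - 1) / 2 * L * (\<tau> ^ (2 * k) - 1) +
        (\<i> * P / of_real pi) * (\<tau> ^ (2 * k) / \<tau> * X (- 1 / \<tau>) + \<tau> * X \<tau>)"
    unfolding F F' A_def [symmetric] by (simp add: algebra_simps)
  also note 3
  finally show ?thesis
    by (simp only: \<tau>_def z'_def P_def L_def b_def c_def mult.commute[of z])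
qed

end
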